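(* Let $R$ be a ring with unity, let $\mathcal{X}$ be a semibrick of left $R$-modules and let $M$ be an $\mathcal{X}$-semisimple module. Suppose $M=\bigoplus_{i\in I}M_i$, where each $M_i$ is isomorphic to a brick in $\mathcal{X}$. (a) Let $U$ be a finitely presented $\mathcal{X}$-semisimple submodule of $M$. Then there exists a subset $I'\subseteq I$ such that $M=\bigoplus_{i\in I'}M_i\oplus U$. (b) Let $V$ be a submodule of $M$ which is isomorphic to a brick in $\mathcal{X}$, and let $U$ be an $\mathcal{X}$-semisimple submodule of $M$. If $V\cap U\ne0$, then $V\subseteq U$.
   Context: A brick is a finitely presented left $R$-module whose endomorphism ring is a division ring. A semibrick is a class $\mathcal{X}$ of pairwise non-isomorphic bricks with $\mathrm{Hom}(X,X')=0$ for distinct $X,X'\in\mathcal{X}$. A module is $\mathcal{X}$-semisimple if it is isomorphic to a (possibly empty or infinite) direct sum of objects from $\mathcal{X}$ (repetitions allowed). The direct sum decompositions of $M$ are internal. *)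

theory Defs
  imports "HOL-Algebra.Algebra"
begin

text \<open>The locale \<^locale>\<open>module\<close> of HOL-Algebra is restricted to commutative rings. The record type
  and the locale \<^locale>\<open>submodule\<close> do not depend on commutativity and are reused here. The
  fields \<^const>\<open>monoid.mult\<close> and \<^const>\<open>monoid.one\<close> of a module record carry no information.\<close>

locale left_module = R?: ring R + M?: abelian_group M
  for R :: "('r, 'e) ring_scheme" (structure) and M :: "('r, 'm, 'z) module_scheme" (structure) +
  assumes smult_closed [simp, intro]:
      "\<lbrakk>a \<in> carrier R; x \<in> carrier M\<rbrakk> \<Longrightarrow> a \<odot>\<^bsub>M\<^esub> x \<in> carrier M"
    and smult_l_distr:
      "\<lbrakk>a \<in> carrier R; b \<in> carrier R; x \<in> carrier M\<rbrakk> \<Longrightarrow>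
        (a \<oplus> b) \<odot>\<^bsub>M\<^esub> x = a \<odot>\<^bsub>M\<^esub> x \<oplus>\<^bsub>M\<^esub> b \<odot>\<^bsub>M\<^esub> x"
    and smult_r_distr:
      "\<lbrakk>a \<in> carrier R; x \<in> carrier M; y \<in> carrier M\<rbrakk> \<Longrightarrow>
        a \<odot>\<^bsub>M\<^esub> (x \<oplus>\<^bsub>M\<^esub> y) = a \<odot>\<^bsub>M\<^esub> x \<oplus>\<^bsub>M\<^esub> a \<odot>\<^bsub>M\<^esub> y"
    and smult_assoc1:
      "\<lbrakk>a \<in> carrier R; b \<in> carrier R; x \<in> carrier M\<rbrakk> \<Longrightarrow>
        (a \<otimes> b) \<odot>\<^bsub>M\<^esub> x = a \<odot>\<^bsub>M\<^esub> (b \<odot>\<^bsub>M\<^esub> x)"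
    and smult_one [simp]:
      "x \<in> carrier M \<Longrightarrow> \<one> \<odot>\<^bsub>M\<^esub> x = x"

definition lmod_hom ::
  "('r, 'e) ring_scheme \<Rightarrow> ('r, 'm, 'y) module_scheme \<Rightarrow> ('r, 'n, 'z) module_scheme \<Rightarrow> ('m \<Rightarrow> 'n) set"
  where "lmod_hom R M N =
    {f \<in> hom (add_monoid M) (add_monoid N).
      \<forall>a \<in> carrier R. \<forall>x \<in> carrier M. f (a \<odot>\<^bsub>M\<^esub> x) = a \<odot>\<^bsub>N\<^esub> f x}"

definition lmod_isomorphic ::
  "('r, 'e) ring_scheme \<Rightarrow> ('r, 'm, 'y) module_scheme \<Rightarrow> ('r, 'n, 'z) module_scheme \<Rightarrow> bool"
  where "lmod_isomorphic R M N \<longleftrightarrow>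
    (\<exists>f \<in> lmod_hom R M N. bij_betw f (carrier M) (carrier N))"

definition direct_sum ::
  "'i set \<Rightarrow> ('i \<Rightarrow> ('r, 'm, 'z) module_scheme) \<Rightarrow> ('r, 'i \<Rightarrow> 'm) module"
  where "direct_sum I N =
    \<lparr>carrier = {x \<in> \<Pi>\<^sub>E i\<in>I. carrier (N i). finite {i \<in> I. x i \<noteq> \<zero>\<^bsub>N i\<^esub>}},
     monoid.mult = undefined,
     monoid.one = undefined,
     ring.zero = (\<lambda>i\<in>I. \<zero>\<^bsub>N i\<^esub>),
     add = (\<lambda>x y. \<lambda>i\<in>I. x i \<oplus>\<^bsub>N i\<^esub> y i),
     smult = (\<lambda>a x. \<lambda>i\<in>I. a \<odot>\<^bsub>N i\<^esub> x i)\<rparr>"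

text \<open>The sum is internal when the canonical map from the external direct sum, which sends
  a finitely supported family to its sum in \<open>M\<close>, is bijective.\<close>

definition internal_direct_sum ::
  "('r, 'e) ring_scheme \<Rightarrow> ('r, 'm, 'z) module_scheme \<Rightarrow> 'i set \<Rightarrow> ('i \<Rightarrow> 'm set) \<Rightarrow> bool"
  where "internal_direct_sum R M I N \<longleftrightarrow>
    (\<forall>i \<in> I. submodule (N i) R M) \<and>
    bij_betw (\<lambda>x. \<Oplus>\<^bsub>M\<^esub> i \<in> {i \<in> I. x i \<noteq> \<zero>\<^bsub>M\<^esub>}. x i)
      (carrier (direct_sum I (\<lambda>i. M\<lparr>carrier := N i\<rparr>))) (carrier M)"

definition regular_module :: "('r, 'e) ring_scheme \<Rightarrow> ('r, 'r) module"
  where "regular_module R =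
    \<lparr>carrier = carrier R, monoid.mult = monoid.mult R, monoid.one = \<one>\<^bsub>R\<^esub>,
     ring.zero = \<zero>\<^bsub>R\<^esub>, add = add R, smult = monoid.mult R\<rparr>"

definition free_module :: "('r, 'e) ring_scheme \<Rightarrow> nat \<Rightarrow> ('r, nat \<Rightarrow> 'r) module"
  where "free_module R n = direct_sum {..<n} (\<lambda>_. regular_module R)"

text \<open>Existence of an exact sequence \<open>R\<^sup>m \<rightarrow> R\<^sup>n \<rightarrow> M \<rightarrow> 0\<close>.\<close>

definition finitely_presented ::
  "('r, 'e) ring_scheme \<Rightarrow> ('r, 'm, 'z) module_scheme \<Rightarrow> bool"
  where "finitely_presented R M \<longleftrightarrow>
    (\<exists>m n. \<exists>f \<in> lmod_hom R (free_module R m) (free_module R n). \<exists>g \<in> lmod_hom R (free_module R n) M.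
      f ` carrier (free_module R m) = {x \<in> carrier (free_module R n). g x = \<zero>\<^bsub>M\<^esub>} \<and>
      g ` carrier (free_module R n) = carrier M)"

text \<open>Endomorphisms are taken extensional on the carrier, so that equality in the ring is
  equality of maps on \<^term>\<open>carrier M\<close>.\<close>

definition end_ring ::
  "('r, 'e) ring_scheme \<Rightarrow> ('r, 'm, 'z) module_scheme \<Rightarrow> ('m \<Rightarrow> 'm) ring"
  where "end_ring R M =
    \<lparr>carrier = lmod_hom R M M \<inter> extensional (carrier M),
     monoid.mult = compose (carrier M),
     monoid.one = (\<lambda>x\<in>carrier M. x),
     ring.zero = (\<lambda>x\<in>carrier M. \<zero>\<^bsub>M\<^esub>),
     add = (\<lambda>f g. \<lambda>x\<in>carrier M. f x \<oplus>\<^bsub>M\<^esub> g x)\<rparr>"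

locale div_ring = ring +
  assumes one_not_zero [simp]: "\<one> \<noteq> \<zero>"
    and div_ring_Units: "Units R = carrier R - {\<zero>}"

definition brick :: "('r, 'e) ring_scheme \<Rightarrow> ('r, 'm, 'z) module_scheme \<Rightarrow> bool"
  where "brick R M \<longleftrightarrow>
    left_module R M \<and> finitely_presented R M \<and> div_ring (end_ring R M)"

text \<open>A semibrick is represented by a set of modules with carriers in one type. This is no
  restriction: finitely presented modules over \<open>R\<close> form a set up to isomorphism, and the
  members of a semibrick are pairwise non-isomorphic.\<close>

definition semibrick :: "('r, 'e) ring_scheme \<Rightarrow> ('r, 'b, 'z) module_scheme set \<Rightarrow> bool"
  where "semibrick R \<B> \<longleftrightarrow>
    (\<forall>B \<in> \<B>. brick R B) \<and>
    (\<forall>B \<in> \<B>. \<forall>B' \<in> \<B>. B \<noteq> B' \<longrightarrow>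
      \<not> lmod_isomorphic R B B' \<and>
      (\<forall>f \<in> lmod_hom R B B'. \<forall>x \<in> carrier B. f x = \<zero>\<^bsub>B'\<^esub>))"

text \<open>The index set of the direct sum is taken in the carrier type of \<open>M\<close>. This loses nothing
  when \<open>\<B>\<close> consists of bricks: the summands are then nonzero, so choosing a nonzero element in
  each of them embeds any index set into \<^term>\<open>carrier M\<close>.\<close>

definition semisimple_over ::
  "('r, 'e) ring_scheme \<Rightarrow> ('r, 'b, 'y) module_scheme set \<Rightarrow> ('r, 'm, 'z) module_scheme \<Rightarrow> bool"
  where "semisimple_over R \<B> M \<longleftrightarrow>
    (\<exists>(I :: 'm set) N. (\<forall>i \<in> I. N i \<in> \<B>) \<and> lmod_isomorphic R M (direct_sum I N))"

end

theory Submission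
  imports Defs
begin

text \<open>A nonzero homomorphism between modules isomorphic to members of a semibrick is bijective.
  Write a semisimple submodule \<open>U\<close> as a sum of bricks \<open>U\<^sub>j\<close>. The bricks in a finite partial sum
  are exchanged one after the other for summands \<open>M\<^sub>i\<close>: as \<open>U\<^sub>j\<close> is not contained in the part of
  \<open>U\<close> treated so far, one of its components in the remaining \<open>M\<^sub>i\<close> is nonzero, hence bijective.
  So every finite partial sum of \<open>U\<close> has a complement that is a sum of some of the \<open>M\<^sub>i\<close>. If \<open>U\<close>
  is finitely generated, this applies to \<open>U\<close> itself. For (b), a nonzero element of \<open>V \<inter> U\<close> lies in
  a finite partial sum; the components of \<open>V\<close> in the complement kill it, so they are not
  injective, hence zero, and \<open>V\<close> is contained in that partial sum.\<close>

section \<open>Homomorphisms of left modules\<close>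

lemma lmod_homI:
  assumes "\<And>x. x \<in> carrier M \<Longrightarrow> f x \<in> carrier N"
    and "\<And>x y. x \<in> carrier M \<Longrightarrow> y \<in> carrier M \<Longrightarrow> f (x \<oplus>\<^bsub>M\<^esub> y) = f x \<oplus>\<^bsub>N\<^esub> f y"
    and "\<And>a x. a \<in> carrier R \<Longrightarrow> x \<in> carrier M \<Longrightarrow> f (a \<odot>\<^bsub>M\<^esub> x) = a \<odot>\<^bsub>N\<^esub> f x"
  shows "f \<in> lmod_hom R M N"
  using assms by (auto simp: lmod_hom_def hom_def)

lemma lmod_hom_closed: "f \<in> lmod_hom R M N \<Longrightarrow> x \<in> carrier M \<Longrightarrow> f x \<in> carrier N"
  by (auto simp: lmod_hom_def hom_def)

lemma lmod_hom_add:
  "f \<in> lmod_hom R M N \<Longrightarrow> x \<in> carrier M \<Longrightarrow> y \<in> carrier M \<Longrightarrow>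
    f (x \<oplus>\<^bsub>M\<^esub> y) = f x \<oplus>\<^bsub>N\<^esub> f y"
  by (auto simp: lmod_hom_def hom_def)

lemma lmod_hom_smult:
  "f \<in> lmod_hom R M N \<Longrightarrow> a \<in> carrier R \<Longrightarrow> x \<in> carrier M \<Longrightarrow>
    f (a \<odot>\<^bsub>M\<^esub> x) = a \<odot>\<^bsub>N\<^esub> f x"
  by (auto simp: lmod_hom_def)

lemma lmod_hom_comp:
  assumes "f \<in> lmod_hom R M N" "g \<in> lmod_hom R N P"
  shows "g \<circ> f \<in> lmod_hom R M P"
  by (rule lmod_homI)
    (simp_all add: lmod_hom_closed[OF assms(1)] lmod_hom_closed[OF assms(2)] lmod_hom_add[OF assms(1)]
      lmod_hom_add[OF assms(2)] lmod_hom_smult[OF assms(1)] lmod_hom_smult[OF assms(2)])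

lemma lmod_hom_restrict_dom:
  "f \<in> lmod_hom R M N \<Longrightarrow> A \<subseteq> carrier M \<Longrightarrow> f \<in> lmod_hom R (M\<lparr>carrier := A\<rparr>) N"
  by (rule lmod_homI) (auto intro: lmod_hom_closed dest: lmod_hom_add lmod_hom_smult)

lemma lmod_hom_superset:
  assumes f: "f \<in> lmod_hom R M (N\<lparr>carrier := A\<rparr>)" and "A \<subseteq> carrier N"
  shows "f \<in> lmod_hom R M N"
  by (rule lmod_homI)
    (use lmod_hom_closed[OF f] lmod_hom_add[OF f] lmod_hom_smult[OF f] assms(2) in auto)

lemma lmod_hom_zero:
  assumes "f \<in> lmod_hom R M N" "abelian_group M" "abelian_group N"
  shows "f \<zero>\<^bsub>M\<^esub> = \<zero>\<^bsub>N\<^esub>"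
proof -
  interpret M: abelian_group M by fact
  interpret N: abelian_group N by fact
  have "f \<zero>\<^bsub>M\<^esub> \<oplus>\<^bsub>N\<^esub> f \<zero>\<^bsub>M\<^esub> = f \<zero>\<^bsub>M\<^esub>"
    using lmod_hom_add[OF assms(1) M.zero_closed M.zero_closed] by simp
  then show ?thesis
    using lmod_hom_closed[OF assms(1) M.zero_closed] N.add.r_cancel_one' by metis
qed

lemma lmod_hom_minus:
  assumes "f \<in> lmod_hom R M N" "abelian_group M" "abelian_group N" "x \<in> carrier M" "y \<in> carrier M"
  shows "f (x \<ominus>\<^bsub>M\<^esub> y) = f x \<ominus>\<^bsub>N\<^esub> f y"
proof -
  interpret M: abelian_group M by fact
  interpret N: abelian_group N by fact
  have "f (\<ominus>\<^bsub>M\<^esub> y) \<oplus>\<^bsub>N\<^esub> f y = \<zero>\<^bsub>N\<^esub>"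
    using lmod_hom_add[OF assms(1), of "\<ominus>\<^bsub>M\<^esub> y" y] assms lmod_hom_zero[OF assms(1-3)]
    by (simp add: M.l_neg)
  then have "f (\<ominus>\<^bsub>M\<^esub> y) = \<ominus>\<^bsub>N\<^esub> f y"
    using assms N.minus_equality lmod_hom_closed[OF assms(1)] by (metis M.a_inv_closed)
  then show ?thesis
    using lmod_hom_add[OF assms(1), of x "\<ominus>\<^bsub>M\<^esub> y"] assms by (simp add: a_minus_def)
qed

lemma lmod_hom_inv_into:
  assumes "f \<in> lmod_hom R M N" "bij_betw f (carrier M) (carrier N)" "left_module R M"
  shows "inv_into (carrier M) f \<in> lmod_hom R N M"
proof -
  interpret left_module R M by fact
  let ?g = "inv_into (carrier M) f"
  have g: "?g y \<in> carrier M" "f (?g y) = y" if "y \<in> carrier N" for y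
    using assms(2) that bij_betw_inv_into[OF assms(2)]
    by (auto simp: bij_betw_inv_into_right bij_betw_def inv_into_into)
  have gf: "?g (f x) = x" if "x \<in> carrier M" for x
    using assms(2) that by (simp add: bij_betw_inv_into_left)
  show ?thesis
  proof (rule lmod_homI)
    fix x y assume "x \<in> carrier N" "y \<in> carrier N"
    then show "?g (x \<oplus>\<^bsub>N\<^esub> y) = ?g x \<oplus>\<^bsub>M\<^esub> ?g y"
      using gf[of "?g x \<oplus>\<^bsub>M\<^esub> ?g y"] lmod_hom_add[OF assms(1)] g by simp
  next
    fix a x assume "a \<in> carrier R" "x \<in> carrier N"
    then show "?g (a \<odot>\<^bsub>N\<^esub> x) = a \<odot>\<^bsub>M\<^esub> ?g x"
      using gf[of "a \<odot>\<^bsub>M\<^esub> ?g x"] lmod_hom_smult[OF assms(1)] g by simp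
  qed (rule g)
qed

lemma lmod_hom_finsum:
  assumes f: "f \<in> lmod_hom R M N" and "abelian_group M" "abelian_group N"
    and "finite A" "\<And>i. i \<in> A \<Longrightarrow> x i \<in> carrier M"
  shows "f (finsum M x A) = finsum N (\<lambda>i. f (x i)) A"
proof -
  interpret M: abelian_group M by fact
  interpret N: abelian_group N by fact
  show ?thesis
    using assms(4,5)
  proof (induction A)
    case empty
    then show ?case using lmod_hom_zero[OF assms(1-3)] by simp
  next
    case (insert i A)
    then have "finsum M x (insert i A) = x i \<oplus>\<^bsub>M\<^esub> finsum M x A"
      by (intro M.finsum_insert) auto
    moreover have "finsum N (\<lambda>i. f (x i)) (insert i A) = f (x i) \<oplus>\<^bsub>N\<^esub> finsum N (\<lambda>i. f (x i)) A"
      using insert by (intro N.finsum_insert) (auto intro: lmod_hom_closed[OF f])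
    ultimately show ?case
      using insert lmod_hom_add[OF f, of "x i" "finsum M x A"] by (simp add: M.finsum_closed Pi_def)
  qed
qed

section \<open>Submodules\<close>

context left_module
begin

lemma smult_r_null: "a \<in> carrier R \<Longrightarrow> a \<odot>\<^bsub>M\<^esub> \<zero>\<^bsub>M\<^esub> = \<zero>\<^bsub>M\<^esub>"
  using smult_r_distr[of a "\<zero>\<^bsub>M\<^esub>" "\<zero>\<^bsub>M\<^esub>"] M.add.r_cancel_one'[of "a \<odot>\<^bsub>M\<^esub> \<zero>\<^bsub>M\<^esub>" "a \<odot>\<^bsub>M\<^esub> \<zero>\<^bsub>M\<^esub>"]
  by simp

lemma smult_l_null: "x \<in> carrier M \<Longrightarrow> \<zero>\<^bsub>R\<^esub> \<odot>\<^bsub>M\<^esub> x = \<zero>\<^bsub>M\<^esub>"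
  using smult_l_distr[of "\<zero>\<^bsub>R\<^esub>" "\<zero>\<^bsub>R\<^esub>" x] M.add.r_cancel_one'[of "\<zero>\<^bsub>R\<^esub> \<odot>\<^bsub>M\<^esub> x" "\<zero>\<^bsub>R\<^esub> \<odot>\<^bsub>M\<^esub> x"]
  by simp

lemma smult_l_minus: "x \<in> carrier M \<Longrightarrow> \<ominus>\<^bsub>M\<^esub> x = (\<ominus>\<^bsub>R\<^esub> \<one>\<^bsub>R\<^esub>) \<odot>\<^bsub>M\<^esub> x"
  using smult_l_distr[of "\<ominus>\<^bsub>R\<^esub> \<one>\<^bsub>R\<^esub>" "\<one>\<^bsub>R\<^esub>" x] smult_l_null[of x]
  by (simp add: R.l_neg M.minus_equality)

lemma finsum_smult:
  assumes "a \<in> carrier R" "finite A" "\<And>i. i \<in> A \<Longrightarrow> x i \<in> carrier M"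
  shows "a \<odot>\<^bsub>M\<^esub> finsum M x A = finsum M (\<lambda>i. a \<odot>\<^bsub>M\<^esub> x i) A"
  using assms(2,3)
proof (induction A)
  case empty
  then show ?case using assms(1) by (simp add: smult_r_null)
next
  case (insert i A)
  then show ?case
    using assms(1) by (simp add: Pi_def M.finsum_insert M.finsum_closed smult_r_distr)
qed

lemma submoduleI:
  assumes "H \<subseteq> carrier M" "\<zero>\<^bsub>M\<^esub> \<in> H"
    and "\<And>x y. x \<in> H \<Longrightarrow> y \<in> H \<Longrightarrow> x \<oplus>\<^bsub>M\<^esub> y \<in> H"
    and "\<And>a x. a \<in> carrier R \<Longrightarrow> x \<in> H \<Longrightarrow> a \<odot>\<^bsub>M\<^esub> x \<in> H"
  shows "submodule H R M"
proof -
  have "subgroup H (add_monoid M)"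
    using assms(1,2,3)
  proof (intro M.add.subgroupI)
    fix x assume "x \<in> H"
    then show "\<ominus>\<^bsub>M\<^esub> x \<in> H"
      using assms(1) assms(4)[of "\<ominus>\<^bsub>R\<^esub> \<one>\<^bsub>R\<^esub>" x] smult_l_minus[of x] by auto
  qed auto
  then show ?thesis
    using assms(4) by (simp add: submodule_def submodule_axioms_def)
qed

lemma submoduleD:
  assumes "submodule H R M"
  shows "H \<subseteq> carrier M" "\<zero>\<^bsub>M\<^esub> \<in> H"
    and "x \<in> H \<Longrightarrow> y \<in> H \<Longrightarrow> x \<oplus>\<^bsub>M\<^esub> y \<in> H"
    and "x \<in> H \<Longrightarrow> \<ominus>\<^bsub>M\<^esub> x \<in> H"
    and "a \<in> carrier R \<Longrightarrow> x \<in> H \<Longrightarrow> a \<odot>\<^bsub>M\<^esub> x \<in> H"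
proof -
  interpret submodule H R M by fact
  show "H \<subseteq> carrier M" "\<zero>\<^bsub>M\<^esub> \<in> H"
    "x \<in> H \<Longrightarrow> y \<in> H \<Longrightarrow> x \<oplus>\<^bsub>M\<^esub> y \<in> H"
    "a \<in> carrier R \<Longrightarrow> x \<in> H \<Longrightarrow> a \<odot>\<^bsub>M\<^esub> x \<in> H"
    using subset one_closed m_closed by auto
  show "x \<in> H \<Longrightarrow> \<ominus>\<^bsub>M\<^esub> x \<in> H"
    using m_inv_closed by (simp add: a_inv_def)
qed

lemma left_module_submodule:
  assumes "submodule H R M"
  shows "left_module R (M\<lparr>carrier := H\<rparr>)"
proof -
  note D = submoduleD[OF assms]
  have sub: "x \<in> carrier M" if "x \<in> H" for x
    using D(1) that by auto
  have "abelian_group (M\<lparr>carrier := H\<rparr>)"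
  proof (rule abelian_groupI)
    fix x assume "x \<in> carrier (M\<lparr>carrier := H\<rparr>)"
    then show "\<exists>y\<in>carrier (M\<lparr>carrier := H\<rparr>). y \<oplus>\<^bsub>M\<lparr>carrier := H\<rparr>\<^esub> x = \<zero>\<^bsub>M\<lparr>carrier := H\<rparr>\<^esub>"
      using D(4)[of x] sub by (auto intro!: bexI[of _ "\<ominus>\<^bsub>M\<^esub> x"] simp: M.l_neg)
  qed (use D sub in \<open>auto simp: M.a_ac\<close>)
  then show ?thesis
    using D sub R.ring_axioms
    by (auto simp: left_module_def left_module_axioms_def smult_l_distr smult_r_distr smult_assoc1)
qed

lemma submodule_set_add:
  assumes "submodule U R M" "submodule V R M"
  shows "submodule (U <+>\<^bsub>M\<^esub> V) R M"
proof -
  note U = submoduleD[OF assms(1)] and V = submoduleD[OF assms(2)]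
  show ?thesis
  proof (rule submoduleI)
    show "U <+>\<^bsub>M\<^esub> V \<subseteq> carrier M"
      using U(1) V(1) by (auto simp: set_add_def')
    show "\<zero>\<^bsub>M\<^esub> \<in> U <+>\<^bsub>M\<^esub> V"
      using U(2) V(2) by (force simp: set_add_def')
  next
    fix x y assume "x \<in> U <+>\<^bsub>M\<^esub> V" "y \<in> U <+>\<^bsub>M\<^esub> V"
    then obtain u v u' v' where *: "u \<in> U" "v \<in> V" "x = u \<oplus>\<^bsub>M\<^esub> v" "u' \<in> U" "v' \<in> V" "y = u' \<oplus>\<^bsub>M\<^esub> v'"
      by (auto simp: set_add_def')
    then have "x \<oplus>\<^bsub>M\<^esub> y = (u \<oplus>\<^bsub>M\<^esub> u') \<oplus>\<^bsub>M\<^esub> (v \<oplus>\<^bsub>M\<^esub> v')"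
      using U(1) V(1) by (simp add: M.add.m_ac subset_iff)
    then show "x \<oplus>\<^bsub>M\<^esub> y \<in> U <+>\<^bsub>M\<^esub> V"
      using U(3)[of u u'] V(3)[of v v'] * unfolding set_add_def' by blast
  next
    fix a x assume "a \<in> carrier R" "x \<in> U <+>\<^bsub>M\<^esub> V"
    then obtain u v where *: "u \<in> U" "v \<in> V" "x = u \<oplus>\<^bsub>M\<^esub> v"
      by (auto simp: set_add_def')
    then have "a \<odot>\<^bsub>M\<^esub> x = a \<odot>\<^bsub>M\<^esub> u \<oplus>\<^bsub>M\<^esub> a \<odot>\<^bsub>M\<^esub> v"
      using U(1) V(1) \<open>a \<in> carrier R\<close> by (simp add: subset_iff smult_r_distr)
    then show "a \<odot>\<^bsub>M\<^esub> x \<in> U <+>\<^bsub>M\<^esub> V"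
      using U(5)[of a u] V(5)[of a v] * \<open>a \<in> carrier R\<close> unfolding set_add_def' by blast
  qed
qed

end

section \<open>Internal direct sums and projections\<close>

definition projections ::
  "('r, 'e) ring_scheme \<Rightarrow> ('r, 'm, 'z) module_scheme \<Rightarrow> 'i set \<Rightarrow> ('i \<Rightarrow> 'm set) \<Rightarrow>
    ('i \<Rightarrow> 'm \<Rightarrow> 'm) \<Rightarrow> bool"
  where "projections R M I N p \<longleftrightarrow>
    (\<forall>i\<in>I. submodule (N i) R M \<and> p i \<in> lmod_hom R M (M\<lparr>carrier := N i\<rparr>)) \<and>
    (\<forall>i\<in>I. \<forall>j\<in>I. \<forall>x\<in>N j. p i x = (if i = j then x else \<zero>\<^bsub>M\<^esub>)) \<and>
    (\<forall>x\<in>carrier M. \<exists>F. finite F \<and> F \<subseteq> I \<and> (\<forall>i\<in>I - F. p i x = \<zero>\<^bsub>M\<^esub>) \<and>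
      x = finsum M (\<lambda>i. p i x) F)"

lemma projectionsD:
  assumes "projections R M I N p"
  shows "i \<in> I \<Longrightarrow> submodule (N i) R M"
    and "i \<in> I \<Longrightarrow> p i \<in> lmod_hom R M (M\<lparr>carrier := N i\<rparr>)"
    and "i \<in> I \<Longrightarrow> j \<in> I \<Longrightarrow> x \<in> N j \<Longrightarrow> p i x = (if i = j then x else \<zero>\<^bsub>M\<^esub>)"
  using assms by (auto simp: projections_def)

lemma projections_finsumE:
  assumes "projections R M I N p" "x \<in> carrier M"
  obtains F where "finite F" "F \<subseteq> I" "\<And>i. i \<in> I - F \<Longrightarrow> p i x = \<zero>\<^bsub>M\<^esub>"
    "x = finsum M (\<lambda>i. p i x) F"
proof -
  have "\<exists>F. finite F \<and> F \<subseteq> I \<and> (\<forall>i\<in>I - F. p i x = \<zero>\<^bsub>M\<^esub>) \<and> x = finsum M (\<lambda>i. p i x) F"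
    using assms by (simp add: projections_def)
  then show ?thesis
    using that by metis
qed

context left_module
begin

context
  fixes I :: "'i set" and N :: "'i \<Rightarrow> 'm set" and D :: "('i \<Rightarrow> 'm) set" and s :: "('i \<Rightarrow> 'm) \<Rightarrow> 'm"
  assumes N: "\<And>i. i \<in> I \<Longrightarrow> submodule (N i) R M"
  defines "D \<equiv> carrier (direct_sum I (\<lambda>i. M\<lparr>carrier := N i\<rparr>))"
    and "s \<equiv> \<lambda>x. \<Oplus>\<^bsub>M\<^esub> i \<in> {i \<in> I. x i \<noteq> \<zero>\<^bsub>M\<^esub>}. x i"
begin

lemma mem_D_iff: "x \<in> D \<longleftrightarrow> x \<in> extensional I \<and> (\<forall>i\<in>I. x i \<in> N i) \<and> finite {i\<in>I. x i \<noteq> \<zero>\<^bsub>M\<^esub>}"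
  by (auto simp: D_def direct_sum_def PiE_iff)

lemma support_sum_eq:
  assumes "x \<in> D" "finite F" "F \<subseteq> I" "\<And>i. i \<in> I - F \<Longrightarrow> x i = \<zero>\<^bsub>M\<^esub>"
  shows "s x = finsum M x F"
  unfolding s_def
proof (rule M.add.finprod_mono_neutral_cong_left)
  show "x \<in> F \<rightarrow> carrier M"
    using assms N submoduleD(1) by (fastforce simp: mem_D_iff)
qed (use assms in auto)

lemma projections_if_bij:
  assumes bij: "bij_betw s D (carrier M)"
  shows "\<exists>p. projections R M I N p"
proof -
  define e where "e = inv_into D s"
  define p where "p i x = e x i" for i x
  have e: "e x \<in> D" "s (e x) = x" if "x \<in> carrier M" for x
    using bij that by (auto simp: e_def bij_betw_inv_into_right bij_betw_def inv_into_into)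
  have es: "e (s x) = x" if "x \<in> D" for x
    using bij that by (simp add: e_def bij_betw_inv_into_left)
  have NM: "x \<in> carrier M" if "i \<in> I" "x \<in> N i" for i x
    using submoduleD(1)[OF N] that by auto
  have dM: "x i \<in> carrier M" if "x \<in> D" "i \<in> I" for x i
    using that NM by (simp add: mem_D_iff)
  have eM: "e x i \<in> carrier M" if "x \<in> carrier M" "i \<in> I" for x i
    using dM e(1) that by blast
  have supp: "finite {i\<in>I. x i \<noteq> \<zero>\<^bsub>M\<^esub>}" if "x \<in> D" for x
    using that by (simp add: mem_D_iff)
  have e_add: "e (x \<oplus>\<^bsub>M\<^esub> y) = (\<lambda>i\<in>I. e x i \<oplus>\<^bsub>M\<^esub> e y i)" if xy: "x \<in> carrier M" "y \<in> carrier M" for x y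
  proof -
    let ?z = "\<lambda>i\<in>I. e x i \<oplus>\<^bsub>M\<^esub> e y i"
    let ?F = "{i\<in>I. e x i \<noteq> \<zero>\<^bsub>M\<^esub>} \<union> {i\<in>I. e y i \<noteq> \<zero>\<^bsub>M\<^esub>}"
    have F: "finite ?F" "?F \<subseteq> I"
      using supp e(1) xy by auto
    have z: "?z \<in> D"
      using e(1)[OF xy(1)] e(1)[OF xy(2)] submoduleD(3)[OF N]
      by (auto simp: mem_D_iff intro: finite_subset[OF _ F(1)])
    have "s ?z = finsum M ?z ?F"
      by (rule support_sum_eq[OF z F]) auto
    also have "\<dots> = finsum M (\<lambda>i. e x i \<oplus>\<^bsub>M\<^esub> e y i) ?F"
      using xy by (intro M.finsum_cong') (auto simp: eM)
    also have "\<dots> = finsum M (e x) ?F \<oplus>\<^bsub>M\<^esub> finsum M (e y) ?F"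
      using xy by (intro M.finsum_addf) (auto simp: eM)
    also have "finsum M (e x) ?F = s (e x)"
      by (rule support_sum_eq[symmetric, OF e(1)[OF xy(1)] F]) auto
    also have "finsum M (e y) ?F = s (e y)"
      by (rule support_sum_eq[symmetric, OF e(1)[OF xy(2)] F]) auto
    finally have "s ?z = x \<oplus>\<^bsub>M\<^esub> y"
      by (simp only: e(2) xy)
    then show ?thesis
      using es[OF z] by simp
  qed
  have e_smult: "e (a \<odot>\<^bsub>M\<^esub> x) = (\<lambda>i\<in>I. a \<odot>\<^bsub>M\<^esub> e x i)"
    if ax: "a \<in> carrier R" "x \<in> carrier M" for a x
  proof -
    let ?z = "\<lambda>i\<in>I. a \<odot>\<^bsub>M\<^esub> e x i"
    let ?F = "{i\<in>I. e x i \<noteq> \<zero>\<^bsub>M\<^esub>}"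
    have F: "finite ?F" "?F \<subseteq> I"
      using supp e(1) ax by auto
    have z: "?z \<in> D"
      using e(1)[OF ax(2)] submoduleD(5)[OF N] ax(1)
      by (auto simp: mem_D_iff smult_r_null intro: finite_subset[OF _ F(1)])
    have "s ?z = finsum M ?z ?F"
      by (rule support_sum_eq[OF z F]) (use ax in \<open>auto simp: smult_r_null\<close>)
    also have "\<dots> = finsum M (\<lambda>i. a \<odot>\<^bsub>M\<^esub> e x i) ?F"
      using ax by (intro M.finsum_cong') (auto simp: eM)
    also have "\<dots> = a \<odot>\<^bsub>M\<^esub> finsum M (e x) ?F"
      by (rule finsum_smult[symmetric]) (use ax F in \<open>auto simp: eM\<close>)
    also have "finsum M (e x) ?F = s (e x)"
      by (rule support_sum_eq[symmetric, OF e(1)[OF ax(2)] F]) auto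
    finally have "s ?z = a \<odot>\<^bsub>M\<^esub> x"
      by (simp only: e(2) ax)
    then show ?thesis
      using es[OF z] by simp
  qed
  have "p i \<in> lmod_hom R M (M\<lparr>carrier := N i\<rparr>)" if "i \<in> I" for i
    by (rule lmod_homI) (use that e(1) in \<open>auto simp: p_def e_add e_smult mem_D_iff\<close>)
  moreover have "p i x = (if i = j then x else \<zero>\<^bsub>M\<^esub>)" if ij: "i \<in> I" "j \<in> I" "x \<in> N j" for i j x
  proof -
    let ?z = "\<lambda>i\<in>I. if i = j then x else \<zero>\<^bsub>M\<^esub>"
    have z: "?z \<in> D"
      using ij submoduleD(2)[OF N] by (auto simp: mem_D_iff intro: finite_subset[of _ "{j}"])
    have "s ?z = finsum M ?z {j}"
      by (rule support_sum_eq[OF z]) (use ij in auto)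
    also have "\<dots> = x"
      using ij NM by (simp add: M.finsum_insert)
    finally have "e x = ?z"
      using es[OF z] by simp
    then show ?thesis
      using ij by (simp add: p_def)
  qed
  moreover have "\<exists>F. finite F \<and> F \<subseteq> I \<and> (\<forall>i\<in>I - F. p i x = \<zero>\<^bsub>M\<^esub>) \<and>
      x = finsum M (\<lambda>i. p i x) F" if x: "x \<in> carrier M" for x
  proof (intro exI conjI)
    show "x = finsum M (\<lambda>i. p i x) {i\<in>I. e x i \<noteq> \<zero>\<^bsub>M\<^esub>}"
      using e(2)[OF x] by (simp add: p_def s_def)
  qed (use supp[OF e(1)[OF x]] in \<open>auto simp: p_def\<close>)
  ultimately show ?thesis
    using N unfolding projections_def by blast
qed

lemma bij_if_projections:
  assumes p: "projections R M I N p"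
  shows "bij_betw s D (carrier M)"
proof -
  have NM: "x \<in> carrier M" if "i \<in> I" "x \<in> N i" for i x
    using submoduleD(1)[OF N] that by auto
  have dM: "x i \<in> carrier M" if "x \<in> D" "i \<in> I" for x i
    using that NM by (simp add: mem_D_iff)
  have ps: "p i (s x) = x i" if i: "i \<in> I" and x: "x \<in> D" for i x
  proof -
    let ?F = "insert i {i\<in>I. x i \<noteq> \<zero>\<^bsub>M\<^esub>}"
    have F: "finite ?F" "?F \<subseteq> I"
      using x i by (auto simp: mem_D_iff)
    have pi: "p i \<in> lmod_hom R M M"
      by (rule lmod_hom_superset[OF projectionsD(2)[OF p i] submoduleD(1)[OF N[OF i]]])
    have "p i (s x) = p i (finsum M x ?F)"
      by (subst support_sum_eq[OF x F]) auto
    also have "\<dots> = finsum M (\<lambda>j. p i (x j)) ?F"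
      by (rule lmod_hom_finsum[OF pi M.abelian_group_axioms M.abelian_group_axioms F(1)])
        (use F x in \<open>auto intro: dM\<close>)
    also have "\<dots> = finsum M (\<lambda>j. if i = j then x j else \<zero>\<^bsub>M\<^esub>) ?F"
    proof (rule M.finsum_cong'[OF refl])
      show "(\<lambda>j. if i = j then x j else \<zero>\<^bsub>M\<^esub>) \<in> ?F \<rightarrow> carrier M"
        using F x by (auto intro: dM)
      show "p i (x j) = (if i = j then x j else \<zero>\<^bsub>M\<^esub>)" if "j \<in> ?F" for j
        using p i that F(2) x unfolding projections_def mem_D_iff by blast
    qed
    also have "\<dots> = x i"
      by (rule M.add.finprod_singleton) (use F x i in \<open>auto intro: dM\<close>)
    finally show ?thesis .
  qed
  show ?thesis
    unfolding bij_betw_def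
  proof (intro conjI subset_antisym subsetI)
    show "inj_on s D"
    proof (rule inj_onI)
      fix x y assume xy: "x \<in> D" "y \<in> D" "s x = s y"
      then have "x i = y i" if "i \<in> I" for i
        using ps[OF that] by metis
      then show "x = y"
        using xy by (auto simp: mem_D_iff intro: extensionalityI)
    qed
  next
    fix y assume "y \<in> s ` D"
    then obtain x where x: "x \<in> D" "y = s x" by auto
    then show "y \<in> carrier M"
      by (auto simp: s_def intro!: M.finsum_closed dM)
  next
    fix x assume x: "x \<in> carrier M"
    from projections_finsumE[OF p this] obtain F where F: "finite F" "F \<subseteq> I"
      "\<And>i. i \<in> I - F \<Longrightarrow> p i x = \<zero>\<^bsub>M\<^esub>" "x = finsum M (\<lambda>i. p i x) F"
      by blast
    have pN: "p i x \<in> N i" if "i \<in> I" for i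
      using lmod_hom_closed[OF projectionsD(2)[OF p that] x] by simp
    let ?z = "\<lambda>i\<in>I. p i x"
    have z: "?z \<in> D"
      using pN F by (auto simp: mem_D_iff intro: finite_subset[OF _ F(1)])
    have "s ?z = finsum M ?z F"
      by (rule support_sum_eq[OF z F(1,2)]) (use F in auto)
    also have "\<dots> = finsum M (\<lambda>i. p i x) F"
      by (rule M.finsum_cong') (use F(2) pN NM in auto)
    also have "\<dots> = x"
      by (rule F(4)[symmetric])
    finally have "x = s ?z" ..
    then show "x \<in> s ` D"
      using z by (rule image_eqI)
  qed
qed

end

lemma internal_direct_sum_iff_projections:
  "internal_direct_sum R M I N \<longleftrightarrow> (\<exists>p. projections R M I N p)"
proof
  assume "internal_direct_sum R M I N"
  then show "\<exists>p. projections R M I N p"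
    by (intro projections_if_bij) (simp_all add: internal_direct_sum_def)
next
  assume "\<exists>p. projections R M I N p"
  then obtain p where p: "projections R M I N p" ..
  then have "submodule (N i) R M" if "i \<in> I" for i
    using that by (simp add: projections_def)
  with bij_if_projections[OF this p] show "internal_direct_sum R M I N"
    by (simp add: internal_direct_sum_def)
qed

lemma projections_mem:
  assumes p: "projections R M (insert k I) N p" and x: "x \<in> carrier M"
    and zero: "\<And>i. i \<in> I \<Longrightarrow> p i x = \<zero>\<^bsub>M\<^esub>"
  shows "x \<in> N k"
proof -
  obtain F where F: "finite F" "F \<subseteq> insert k I" "\<And>i. i \<in> insert k I - F \<Longrightarrow> p i x = \<zero>\<^bsub>M\<^esub>"
    "x = finsum M (\<lambda>i. p i x) F"
    using projections_finsumE[OF p x] by metis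
  note pk = lmod_hom_closed[OF projectionsD(2)[OF p insertI1] x, simplified]
  have pM: "p k x \<in> carrier M"
    using pk submoduleD(1)[OF projectionsD(1)[OF p insertI1]] by auto
  have "finsum M (\<lambda>i. p i x) F = finsum M (\<lambda>i. p i x) {k}"
    by (rule M.add.finprod_mono_neutral_cong) (use F zero pM in auto)
  then have "x = p k x"
    using F(4) pM by (simp add: M.finsum_insert)
  then show ?thesis
    using pk by simp
qed

end

section \<open>Exchange\<close>

context left_module
begin

lemma smult_r_minus:
  assumes "a \<in> carrier R" "x \<in> carrier M"
  shows "a \<odot>\<^bsub>M\<^esub> (\<ominus>\<^bsub>M\<^esub> x) = \<ominus>\<^bsub>M\<^esub> (a \<odot>\<^bsub>M\<^esub> x)"
proof -
  have "a \<odot>\<^bsub>M\<^esub> (\<ominus>\<^bsub>M\<^esub> x) \<oplus>\<^bsub>M\<^esub> a \<odot>\<^bsub>M\<^esub> x = \<zero>\<^bsub>M\<^esub>"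
    using assms smult_r_distr[of a "\<ominus>\<^bsub>M\<^esub> x" x] by (simp add: M.l_neg smult_r_null)
  then show ?thesis
    using assms M.minus_equality by simp
qed

lemma lmod_hom_diff:
  assumes f: "f \<in> lmod_hom R M M" and g: "g \<in> lmod_hom R M M"
  shows "(\<lambda>x. f x \<ominus>\<^bsub>M\<^esub> g x) \<in> lmod_hom R M M"
  using lmod_hom_closed[OF f] lmod_hom_closed[OF g]
  by (intro lmod_homI)
    (simp_all add: a_minus_def lmod_hom_add[OF f] lmod_hom_add[OF g] lmod_hom_smult[OF f]
      lmod_hom_smult[OF g] M.minus_add M.a_ac smult_r_distr smult_r_minus)

lemma lmod_hom_sum:
  assumes f: "f \<in> lmod_hom R M M" and g: "g \<in> lmod_hom R M M"
  shows "(\<lambda>x. f x \<oplus>\<^bsub>M\<^esub> g x) \<in> lmod_hom R M M"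
  using lmod_hom_closed[OF f] lmod_hom_closed[OF g]
  by (intro lmod_homI)
    (simp_all add: lmod_hom_add[OF f] lmod_hom_add[OF g] lmod_hom_smult[OF f]
      lmod_hom_smult[OF g] M.a_ac smult_r_distr)

text \<open>With \<open>y\<close> the composite of \<open>p a\<close> and the inverse of its restriction to \<open>V\<close>, the new
  projections are \<open>p i (x - y x)\<close> for \<open>i \<noteq> b\<close> and \<open>p b (x - y x) + y x\<close> for \<open>i = b\<close>.\<close>

lemma internal_direct_sum_exchange:
  assumes p: "projections R M I N p" and ab: "a \<in> I" "b \<in> I" "a \<noteq> b"
    and V: "submodule V R M" and bij: "bij_betw (p a) V (N a)"
  shows "internal_direct_sum R M (I - {a}) (N(b := N b <+>\<^bsub>M\<^esub> V))"
proof -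
  let ?V = "M\<lparr>carrier := V\<rparr>" and ?Na = "M\<lparr>carrier := N a\<rparr>"
  note MM = M.abelian_group_axioms
  have NM: "N i \<subseteq> carrier M" if "i \<in> I" for i
    by (rule submoduleD(1)[OF projectionsD(1)[OF p that]])
  have VM: "V \<subseteq> carrier M"
    by (rule submoduleD(1)[OF V])
  have ph: "p i \<in> lmod_hom R M M" if "i \<in> I" for i
    by (rule lmod_hom_superset[OF projectionsD(2)[OF p that] NM[OF that]])
  have pN: "p i x \<in> N i" if "i \<in> I" "x \<in> carrier M" for i x
    using lmod_hom_closed[OF projectionsD(2)[OF p that(1)] that(2)] by simp
  define y where "y x = inv_into V (p a) (p a x)" for x
  have "inv_into V (p a) \<in> lmod_hom R ?Na ?V"
    using lmod_hom_inv_into[OF lmod_hom_restrict_dom[OF projectionsD(2)[OF p ab(1)] VM]]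
      bij left_module_submodule[OF V] by simp
  from lmod_hom_comp[OF projectionsD(2)[OF p ab(1)] this] have yV: "y \<in> lmod_hom R M ?V"
    by (simp add: y_def[abs_def] comp_def)
  then have y: "y \<in> lmod_hom R M M"
    using lmod_hom_superset VM by blast
  have y_in: "y x \<in> V" if "x \<in> carrier M" for x
    using lmod_hom_closed[OF yV that] by simp
  have y_V: "y v = v" if "v \<in> V" for v
    using that bij by (simp add: y_def bij_betw_inv_into_left)
  have p_y: "p a (y x) = p a x" if "x \<in> carrier M" for x
    using that bij pN ab(1) by (simp add: y_def bij_betw_inv_into_right)
  have y_N: "y u = \<zero>\<^bsub>M\<^esub>" if "j \<in> I" "j \<noteq> a" "u \<in> N j" for j u
  proof -
    have "p a u = p a \<zero>\<^bsub>M\<^esub>"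
      using projectionsD(3)[OF p ab(1) that(1,3)] that(2) lmod_hom_zero[OF ph[OF ab(1)] MM MM] by simp
    then show ?thesis
      using y_V[OF submoduleD(2)[OF V]] by (simp add: y_def)
  qed
  define d where "d x = x \<ominus>\<^bsub>M\<^esub> y x" for x
  have d: "d \<in> lmod_hom R M M"
    using lmod_hom_diff[OF _ y, of "\<lambda>x. x"] by (simp add: d_def[abs_def] lmod_homI)
  note yM = lmod_hom_closed[OF y] and dM = lmod_hom_closed[OF d]
  have d_y: "d x \<oplus>\<^bsub>M\<^esub> y x = x" if "x \<in> carrier M" for x
    using that yM[OF that] by (simp add: d_def a_minus_def M.a_assoc M.l_neg)
  have p_d: "p a (d x) = \<zero>\<^bsub>M\<^esub>" if "x \<in> carrier M" for x
    using lmod_hom_minus[OF ph[OF ab(1)] MM MM that yM[OF that]] p_y[OF that]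
      lmod_hom_closed[OF ph[OF ab(1)] that] by (simp add: d_def a_minus_def M.r_neg)
  have d_V: "d v = \<zero>\<^bsub>M\<^esub>" if "v \<in> V" for v
    using that VM y_V by (auto simp: d_def a_minus_def M.r_neg)
  have minus_zero: "\<ominus>\<^bsub>M\<^esub> \<zero>\<^bsub>M\<^esub> = \<zero>\<^bsub>M\<^esub>"
    using M.minus_equality[of "\<zero>\<^bsub>M\<^esub>" "\<zero>\<^bsub>M\<^esub>"] by simp
  have d_N: "d u = u" if "j \<in> I" "j \<noteq> a" "u \<in> N j" for j u
    using NM[OF that(1)] that(3) y_N[OF that] by (auto simp: d_def a_minus_def minus_zero)
  define q where "q i = (if i = b then (\<lambda>x. p b (d x) \<oplus>\<^bsub>M\<^esub> y x) else (\<lambda>x. p i (d x)))" for i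
  let ?N = "N(b := N b <+>\<^bsub>M\<^esub> V)"
  have "projections R M (I - {a}) ?N q"
    unfolding projections_def
  proof (intro conjI ballI)
    fix i assume i: "i \<in> I - {a}"
    show "submodule (?N i) R M"
      using i ab(2) projectionsD(1)[OF p] submodule_set_add[OF _ V] by simp
    have "(\<lambda>x. p i (d x)) \<in> lmod_hom R M M" if "i \<in> I" for i
      using lmod_hom_comp[OF d ph[OF that]] by (simp add: comp_def)
    then have qh: "q i \<in> lmod_hom R M M"
      using i ab lmod_hom_sum[OF _ y] by (simp add: q_def)
    have "q i x \<in> ?N i" if "x \<in> carrier M" for x
      using i pN[OF _ dM[OF that], of i] y_in[OF that] unfolding q_def set_add_def'
      by (cases "i = b") auto
    then show "q i \<in> lmod_hom R M (M\<lparr>carrier := ?N i\<rparr>)"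
      by (intro lmod_homI) (simp_all add: lmod_hom_add[OF qh] lmod_hom_smult[OF qh])
  next
    fix i j x assume i: "i \<in> I - {a}" and j: "j \<in> I - {a}" and x: "x \<in> ?N j"
    show "q i x = (if i = j then x else \<zero>\<^bsub>M\<^esub>)"
    proof (cases "j = b")
      case True
      then obtain u v where uv: "u \<in> N b" "v \<in> V" "x = u \<oplus>\<^bsub>M\<^esub> v"
        using x by (auto simp: set_add_def')
      have uM: "u \<in> carrier M" and vM: "v \<in> carrier M"
        using uv NM[OF ab(2)] VM by auto
      have "d x = u"
        using lmod_hom_add[OF d uM vM] uv d_V d_N[OF ab(2) ab(3)[symmetric]] uM by simp
      moreover have "y x = v"
        using lmod_hom_add[OF y uM vM] uv y_V y_N[OF ab(2) ab(3)[symmetric]] vM by simp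
      ultimately show ?thesis
        using True i ab(2) uv projectionsD(3)[OF p _ ab(2) uv(1)] by (simp add: q_def)
    next
      case False
      then have x': "x \<in> N j" and xM: "x \<in> carrier M"
        using x NM j by auto
      then show ?thesis
        using False i j ab d_N[of j x] y_N[of j x] projectionsD(3)[OF p _ _ x'] by (simp add: q_def)
    qed
  next
    fix x assume x: "x \<in> carrier M"
    obtain F where F: "finite F" "F \<subseteq> I" "\<And>i. i \<in> I - F \<Longrightarrow> p i (d x) = \<zero>\<^bsub>M\<^esub>"
      "d x = finsum M (\<lambda>i. p i (d x)) F"
      using projections_finsumE[OF p dM[OF x]] by metis
    let ?G = "F - {a} - {b}" and ?F = "insert b (F - {a} - {b})"
    have pM: "p i (d x) \<in> carrier M" if "i \<in> I" for i
      using lmod_hom_closed[OF ph[OF that] dM[OF x]] .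
    have G: "finite ?G" "b \<notin> ?G" "?G \<subseteq> I"
      using F by auto
    have GM: "(\<lambda>i. p i (d x)) \<in> ?G \<rightarrow> carrier M"
      using pM G by auto
    have "d x = finsum M (\<lambda>i. p i (d x)) ?F"
      by (subst F(4), rule M.add.finprod_mono_neutral_cong)
        (use F p_d[OF x] ab pM in auto)
    also have "\<dots> = p b (d x) \<oplus>\<^bsub>M\<^esub> finsum M (\<lambda>i. p i (d x)) ?G"
      by (rule M.finsum_insert[OF G(1,2) GM pM[OF ab(2)]])
    finally have dx: "d x = p b (d x) \<oplus>\<^bsub>M\<^esub> finsum M (\<lambda>i. p i (d x)) ?G" .
    have "finsum M (\<lambda>i. q i x) ?F = q b x \<oplus>\<^bsub>M\<^esub> finsum M (\<lambda>i. q i x) ?G"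
    proof (rule M.finsum_insert[OF G(1,2)])
      show "(\<lambda>i. q i x) \<in> ?G \<rightarrow> carrier M" "q b x \<in> carrier M"
        using G pM[OF ab(2)] yM[OF x] pM by (auto simp: q_def)
    qed
    also have "finsum M (\<lambda>i. q i x) ?G = finsum M (\<lambda>i. p i (d x)) ?G"
      by (rule M.finsum_cong'[OF refl GM]) (simp add: q_def)
    also have "q b x \<oplus>\<^bsub>M\<^esub> finsum M (\<lambda>i. p i (d x)) ?G =
        (p b (d x) \<oplus>\<^bsub>M\<^esub> finsum M (\<lambda>i. p i (d x)) ?G) \<oplus>\<^bsub>M\<^esub> y x"
      using pM[OF ab(2)] yM[OF x] M.finsum_closed[OF GM] by (simp add: q_def M.a_ac)
    also have "\<dots> = x"
      using dx d_y[OF x] by simp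
    finally have "x = finsum M (\<lambda>i. q i x) ?F" ..
    moreover have "q i x = \<zero>\<^bsub>M\<^esub>" if "i \<in> I - {a} - ?F" for i
      using that F(3) by (auto simp: q_def)
    moreover have "finite ?F" "?F \<subseteq> I - {a}"
      using F ab by auto
    ultimately show "\<exists>F. finite F \<and> F \<subseteq> I - {a} \<and> (\<forall>i\<in>I - {a} - F. q i x = \<zero>\<^bsub>M\<^esub>) \<and>
        x = finsum M (\<lambda>i. q i x) F"
      by blast
  qed
  then show ?thesis
    using internal_direct_sum_iff_projections by blast
qed

lemma internal_direct_sum_insert_None:
  assumes "internal_direct_sum R M I N"
  shows "internal_direct_sum R M (insert None (Some ` I)) (case_option {\<zero>\<^bsub>M\<^esub>} N)"
proof -
  obtain p where p: "projections R M I N p"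
    using assms internal_direct_sum_iff_projections by blast
  have zero: "submodule {\<zero>\<^bsub>M\<^esub>} R M"
    by (rule submoduleI) (simp_all add: smult_r_null)
  have "projections R M (insert None (Some ` I)) (case_option {\<zero>\<^bsub>M\<^esub>} N)
      (case_option (\<lambda>_. \<zero>\<^bsub>M\<^esub>) p)"
    unfolding projections_def
  proof (intro conjI ballI)
    fix i assume i: "i \<in> insert None (Some ` I)"
    then show "submodule (case_option {\<zero>\<^bsub>M\<^esub>} N i) R M"
      using zero projectionsD(1)[OF p] by auto
    show "case_option (\<lambda>_. \<zero>\<^bsub>M\<^esub>) p i \<in> lmod_hom R M (M\<lparr>carrier := case_option {\<zero>\<^bsub>M\<^esub>} N i\<rparr>)"
      using i projectionsD(2)[OF p] by (cases i) (auto simp: smult_r_null intro: lmod_homI)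
  next
    fix i j x
    assume i: "i \<in> insert None (Some ` I)" and j: "j \<in> insert None (Some ` I)"
      and x: "x \<in> case_option {\<zero>\<^bsub>M\<^esub>} N j"
    have "p i \<zero>\<^bsub>M\<^esub> = \<zero>\<^bsub>M\<^esub>" if "i \<in> I" for i
      using projectionsD(3)[OF p that that submoduleD(2)[OF projectionsD(1)[OF p that]]] by simp
    then show "case_option (\<lambda>_. \<zero>\<^bsub>M\<^esub>) p i x = (if i = j then x else \<zero>\<^bsub>M\<^esub>)"
      using i j x projectionsD(3)[OF p] by (cases i; cases j) auto
  next
    fix x assume x: "x \<in> carrier M"
    obtain F where F: "finite F" "F \<subseteq> I" "\<And>i. i \<in> I - F \<Longrightarrow> p i x = \<zero>\<^bsub>M\<^esub>"
      "x = finsum M (\<lambda>i. p i x) F"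
      using projections_finsumE[OF p x] by metis
    have pM: "p i x \<in> carrier M" if "i \<in> I" for i
      using lmod_hom_closed[OF projectionsD(2)[OF p that] x] submoduleD(1)[OF projectionsD(1)[OF p that]]
      by auto
    have "finsum M (\<lambda>i. case_option (\<lambda>_. \<zero>\<^bsub>M\<^esub>) p i x) (Some ` F) = finsum M (\<lambda>i. p i x) F"
      by (subst M.finsum_reindex) (use F pM in auto)
    then have "finite (Some ` F) \<and> Some ` F \<subseteq> insert None (Some ` I) \<and>
        (\<forall>i\<in>insert None (Some ` I) - Some ` F. case_option (\<lambda>_. \<zero>\<^bsub>M\<^esub>) p i x = \<zero>\<^bsub>M\<^esub>) \<and>
        x = finsum M (\<lambda>i. case_option (\<lambda>_. \<zero>\<^bsub>M\<^esub>) p i x) (Some ` F)"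
      using F by (auto simp: image_iff)
    then show "\<exists>F. finite F \<and> F \<subseteq> insert None (Some ` I) \<and>
        (\<forall>i\<in>insert None (Some ` I) - F. case_option (\<lambda>_. \<zero>\<^bsub>M\<^esub>) p i x = \<zero>\<^bsub>M\<^esub>) \<and>
        x = finsum M (\<lambda>i. case_option (\<lambda>_. \<zero>\<^bsub>M\<^esub>) p i x) F"
      by (rule exI)
  qed
  then show ?thesis
    using internal_direct_sum_iff_projections by blast
qed

end

section \<open>Bricks\<close>

lemma brick_nonzero:
  assumes "brick R B"
  shows "\<exists>x\<in>carrier B. x \<noteq> \<zero>\<^bsub>B\<^esub>"
proof (rule ccontr)
  assume "\<not> ?thesis"
  then have "\<one>\<^bsub>end_ring R B\<^esub> = \<zero>\<^bsub>end_ring R B\<^esub>"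
    by (auto simp: end_ring_def restrict_def)
  then show False
    using assms div_ring.one_not_zero unfolding brick_def by blast
qed

lemma brick_endo_bij:
  assumes "brick R B" "k \<in> lmod_hom R B B" "x \<in> carrier B" "k x \<noteq> \<zero>\<^bsub>B\<^esub>"
  shows "bij_betw k (carrier B) (carrier B)"
proof -
  interpret div_ring "end_ring R B"
    using assms by (simp add: brick_def)
  interpret B: left_module R B
    using assms by (simp add: brick_def)
  let ?k = "restrict k (carrier B)"
  have "?k \<in> lmod_hom R B B"
    using lmod_hom_closed[OF assms(2)] lmod_hom_add[OF assms(2)] lmod_hom_smult[OF assms(2)]
    by (intro lmod_homI) auto
  then have "?k \<in> carrier (end_ring R B)"
    by (simp add: end_ring_def)
  moreover have "?k \<noteq> \<zero>\<^bsub>end_ring R B\<^esub>"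
    using assms(3,4) by (auto simp: end_ring_def dest: fun_cong[of _ _ x])
  ultimately have "?k \<in> Units (end_ring R B)"
    using div_ring_Units by simp
  then obtain l where l: "l \<in> carrier (end_ring R B)"
    "l \<otimes>\<^bsub>end_ring R B\<^esub> ?k = \<one>\<^bsub>end_ring R B\<^esub>" "?k \<otimes>\<^bsub>end_ring R B\<^esub> l = \<one>\<^bsub>end_ring R B\<^esub>"
    by (auto simp: Units_def)
  have kc: "k x \<in> carrier B" and lc: "l x \<in> carrier B" if "x \<in> carrier B" for x
    using that l(1) lmod_hom_closed[OF assms(2)] by (auto simp: end_ring_def dest: lmod_hom_closed)
  have "l (k x) = x" "k (l x) = x" if "x \<in> carrier B" for x
    using fun_cong[OF l(2), of x] fun_cong[OF l(3), of x] that lc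
    by (simp_all add: end_ring_def compose_def)
  then show ?thesis
    using kc lc by (intro bij_betw_byWitness[where f' = l]) auto
qed

lemma semibrick_hom_bij:
  assumes sb: "semibrick R \<B>" "B \<in> \<B>" "B' \<in> \<B>"
    and P: "left_module R P" and Y: "left_module R Y"
    and f: "f \<in> lmod_hom R P B" "bij_betw f (carrier P) (carrier B)"
    and g: "g \<in> lmod_hom R Y B'" "bij_betw g (carrier Y) (carrier B')"
    and h: "h \<in> lmod_hom R P Y" and x: "x \<in> carrier P" "h x \<noteq> \<zero>\<^bsub>Y\<^esub>"
  shows "bij_betw h (carrier P) (carrier Y)"
proof -
  interpret P: left_module R P by fact
  interpret Y: left_module R Y by fact
  interpret B': left_module R B'
    using sb by (auto simp: semibrick_def brick_def)
  define k where "k = g \<circ> (h \<circ> inv_into (carrier P) f)"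
  have k: "k \<in> lmod_hom R B B'"
    unfolding k_def by (intro lmod_hom_comp[OF _ g(1)] lmod_hom_comp[OF _ h] lmod_hom_inv_into f P)
  have kf: "k (f z) = g (h z)" if "z \<in> carrier P" for z
    using f(2) that by (simp add: k_def bij_betw_inv_into_left)
  have "g (h x) \<noteq> g \<zero>\<^bsub>Y\<^esub>"
    using g(2) x lmod_hom_closed[OF h x(1)] by (auto simp: bij_betw_def dest: inj_onD)
  then have nz: "k (f x) \<noteq> \<zero>\<^bsub>B'\<^esub>"
    using lmod_hom_zero[OF g(1) Y.M.abelian_group_axioms B'.M.abelian_group_axioms] kf x by simp
  have fx: "f x \<in> carrier B"
    by (rule lmod_hom_closed[OF f(1) x(1)])
  have BB: "B = B'"
  proof (rule ccontr)
    assume "B \<noteq> B'"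
    then have "\<forall>f\<in>lmod_hom R B B'. \<forall>x\<in>carrier B. f x = \<zero>\<^bsub>B'\<^esub>"
      using sb by (simp add: semibrick_def)
    then show False
      using k nz fx by blast
  qed
  then have "bij_betw k (carrier B) (carrier B')"
    using brick_endo_bij[of R B k "f x"] sb k fx nz by (simp add: semibrick_def)
  then have "bij_betw (inv_into (carrier Y) g \<circ> (k \<circ> f)) (carrier P) (carrier Y)"
    by (intro bij_betw_trans[OF _ bij_betw_inv_into[OF g(2)]] bij_betw_trans[OF f(2)])
  moreover have "(inv_into (carrier Y) g \<circ> (k \<circ> f)) z = h z" if "z \<in> carrier P" for z
    using g(2) kf[OF that] lmod_hom_closed[OF h that] by (simp add: bij_betw_inv_into_left)
  ultimately show ?thesis
    using bij_betw_cong by blast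
qed

section \<open>Finite generation and direct sums\<close>

lemma carrier_free_module:
  "carrier (free_module R n) = (\<Pi>\<^sub>E i\<in>{..<n}. carrier R)"
  by (simp add: free_module_def direct_sum_def regular_module_def)

lemma free_module_hom_zero:
  assumes R: "ring R" and B: "left_module R B" and h: "h \<in> lmod_hom R (free_module R n) B"
    and gen: "\<And>k. k < n \<Longrightarrow> h (\<lambda>i\<in>{..<n}. if i = k then \<one>\<^bsub>R\<^esub> else \<zero>\<^bsub>R\<^esub>) = \<zero>\<^bsub>B\<^esub>"
    and x: "x \<in> carrier (free_module R n)"
  shows "h x = \<zero>\<^bsub>B\<^esub>"
proof -
  interpret ring R by fact
  interpret B: left_module R B by fact
  have "h x = \<zero>\<^bsub>B\<^esub>" if "m \<le> n" "x \<in> carrier (free_module R n)" "\<forall>i\<in>{m..<n}. x i = \<zero>\<^bsub>R\<^esub>" for m x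
    using that
  proof (induction m arbitrary: x)
    case 0
    then have "x \<oplus>\<^bsub>free_module R n\<^esub> x = x"
      by (auto simp: carrier_free_module free_module_def direct_sum_def regular_module_def
          PiE_iff extensional_def)
    then have "h x \<oplus>\<^bsub>B\<^esub> h x = h x"
      using lmod_hom_add[OF h 0(2,2)] by metis
    then show ?case
      using lmod_hom_closed[OF h 0(2)] B.M.add.r_cancel_one[of "h x" "h x"] by simp
  next
    case (Suc m)
    let ?e = "\<lambda>i\<in>{..<n}. if i = m then \<one>\<^bsub>R\<^esub> else \<zero>\<^bsub>R\<^esub>"
    let ?x = "\<lambda>i\<in>{..<n}. if i = m then \<zero>\<^bsub>R\<^esub> else x i"
    have xi: "x i \<in> carrier R" if "i < n" for i
      using Suc.prems(2) that by (auto simp: carrier_free_module)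
    have e: "?e \<in> carrier (free_module R n)" and x: "?x \<in> carrier (free_module R n)"
      and xm: "x m \<odot>\<^bsub>free_module R n\<^esub> ?e \<in> carrier (free_module R n)"
      using xi Suc.prems(1)
      by (auto simp: carrier_free_module)
        (auto simp: free_module_def direct_sum_def regular_module_def split: if_splits)
    have "x = ?x \<oplus>\<^bsub>free_module R n\<^esub> (x m \<odot>\<^bsub>free_module R n\<^esub> ?e)"
    proof (rule extensionalityI[where A = "{..<n}"])
      show "x \<in> extensional {..<n}"
        using Suc.prems(2) by (simp add: carrier_free_module PiE_iff)
    qed (use xi Suc.prems(1) in \<open>auto simp: free_module_def direct_sum_def regular_module_def\<close>)
    then have "h x = h ?x \<oplus>\<^bsub>B\<^esub> x m \<odot>\<^bsub>B\<^esub> h ?e"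
      using lmod_hom_add[OF h x xm] lmod_hom_smult[OF h xi e] Suc.prems(1) by simp
    also have "h ?x = \<zero>\<^bsub>B\<^esub>"
      using Suc.prems by (intro Suc.IH[OF _ x]) auto
    also have "h ?e = \<zero>\<^bsub>B\<^esub>"
      using Suc.prems(1) by (intro gen) simp
    finally show ?case
      using xi[of m] Suc.prems(1) by (simp add: B.smult_r_null)
  qed
  from this[of n x] show ?thesis
    using x by simp
qed

context left_module
begin

context
  fixes U :: "'m set" and J :: "'j set" and B :: "'j \<Rightarrow> ('r, 'b, 'y) module_scheme"
    and \<phi> :: "'m \<Rightarrow> 'j \<Rightarrow> 'b" and part :: "'j set \<Rightarrow> 'm set"
  assumes U: "submodule U R M"
    and B: "\<And>j. j \<in> J \<Longrightarrow> left_module R (B j)"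
    and phi: "\<phi> \<in> lmod_hom R (M\<lparr>carrier := U\<rparr>) (direct_sum J B)"
    and phi_bij: "bij_betw \<phi> U (carrier (direct_sum J B))"
  defines "part \<equiv> \<lambda>K. {x \<in> U. \<forall>j\<in>J - K. \<phi> x j = \<zero>\<^bsub>B j\<^esub>}"
begin

lemma carrier_direct_sum_iff:
  "x \<in> carrier (direct_sum J B) \<longleftrightarrow>
    x \<in> extensional J \<and> (\<forall>j\<in>J. x j \<in> carrier (B j)) \<and> finite {j\<in>J. x j \<noteq> \<zero>\<^bsub>B j\<^esub>}"
  by (auto simp: direct_sum_def PiE_iff)

lemma phi_component:
  assumes "j \<in> J"
  shows "(\<lambda>x. \<phi> x j) \<in> lmod_hom R (M\<lparr>carrier := U\<rparr>) (B j)"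
proof (rule lmod_homI)
  show "\<phi> x j \<in> carrier (B j)" if "x \<in> carrier (M\<lparr>carrier := U\<rparr>)" for x
    using lmod_hom_closed[OF phi that] assms by (simp add: carrier_direct_sum_iff)
qed (simp_all add: lmod_hom_add[OF phi, simplified] lmod_hom_smult[OF phi, simplified]
    direct_sum_def assms)

lemma phi_eqI:
  assumes "x \<in> U" "y \<in> U" "\<And>j. j \<in> J \<Longrightarrow> \<phi> x j = \<phi> y j"
  shows "x = y"
proof -
  have "\<phi> x \<in> extensional J" "\<phi> y \<in> extensional J"
    using lmod_hom_closed[OF phi] assms(1,2) by (simp_all add: carrier_direct_sum_iff)
  then have "\<phi> x = \<phi> y"
    using assms(3) by (rule extensionalityI)
  then show ?thesis
    using phi_bij assms by (auto simp: bij_betw_def dest: inj_onD)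
qed

lemma phi_single:
  assumes "j \<in> J" "b \<in> carrier (B j)"
  obtains v where "v \<in> part {j}" "\<phi> v j = b"
proof -
  let ?w = "\<lambda>i\<in>J. if i = j then b else \<zero>\<^bsub>B i\<^esub>"
  have zero: "\<zero>\<^bsub>B i\<^esub> \<in> carrier (B i)" if "i \<in> J" for i
    using B[OF that] by (simp add: left_module_def abelian_group.axioms abelian_monoid.zero_closed)
  have "?w \<in> carrier (direct_sum J B)"
    using assms zero by (auto simp: carrier_direct_sum_iff intro: finite_subset[of _ "{j}"])
  then have "?w \<in> \<phi> ` U"
    using bij_betw_imp_surj_on[OF phi_bij] by simp
  then obtain v where v: "?w = \<phi> v" "v \<in> U"
    by (rule imageE)
  then show thesis
    using assms by (intro that[of v]) (auto simp: part_def simp flip: v(1))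
qed

lemma phi_zero: "j \<in> J \<Longrightarrow> \<phi> \<zero>\<^bsub>M\<^esub> j = \<zero>\<^bsub>B j\<^esub>"
  using lmod_hom_zero[OF phi_component] left_module_submodule[OF U] B[of j]
  by (simp add: left_module_def)

lemma part_submodule: "submodule (part K) R M"
proof (rule submoduleI)
  note D = submoduleD[OF U]
  show "part K \<subseteq> carrier M"
    using D(1) by (auto simp: part_def)
  show "\<zero>\<^bsub>M\<^esub> \<in> part K"
    using D(2) phi_zero by (simp add: part_def)
  show "x \<oplus>\<^bsub>M\<^esub> y \<in> part K" if "x \<in> part K" "y \<in> part K" for x y
  proof -
    have "\<phi> (x \<oplus>\<^bsub>M\<^esub> y) j = \<zero>\<^bsub>B j\<^esub>" if "j \<in> J - K" for j
    proof -
      interpret Bj: left_module R "B j"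
        using B that by simp
      show ?thesis
        using that \<open>x \<in> part K\<close> \<open>y \<in> part K\<close> lmod_hom_add[OF phi_component, of j x y]
        by (simp add: part_def)
    qed
    then show ?thesis
      using that D(3) by (simp add: part_def)
  qed
  show "a \<odot>\<^bsub>M\<^esub> x \<in> part K" if "a \<in> carrier R" "x \<in> part K" for a x
  proof -
    have "\<phi> (a \<odot>\<^bsub>M\<^esub> x) j = \<zero>\<^bsub>B j\<^esub>" if "j \<in> J - K" for j
    proof -
      interpret Bj: left_module R "B j"
        using B that by simp
      show ?thesis
        using that \<open>a \<in> carrier R\<close> \<open>x \<in> part K\<close> lmod_hom_smult[OF phi_component, of j a x]
        by (simp add: part_def Bj.smult_r_null)
    qed
    then show ?thesis
      using that D(5) by (simp add: part_def)
  qed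
qed

lemma part_empty: "part {} = {\<zero>\<^bsub>M\<^esub>}"
proof
  show "part {} \<subseteq> {\<zero>\<^bsub>M\<^esub>}"
  proof
    fix x assume "x \<in> part {}"
    then have "x = \<zero>\<^bsub>M\<^esub>"
      using submoduleD(2)[OF U] phi_zero by (intro phi_eqI) (simp_all add: part_def)
    then show "x \<in> {\<zero>\<^bsub>M\<^esub>}"
      by simp
  qed
qed (use submoduleD(2)[OF part_submodule] in simp)

lemma part_support:
  assumes "x \<in> U"
  obtains K where "finite K" "K \<subseteq> J" "x \<in> part K"
  using lmod_hom_closed[OF phi, of x] assms
  by (intro that[of "{j\<in>J. \<phi> x j \<noteq> \<zero>\<^bsub>B j\<^esub>}"]) (auto simp: carrier_direct_sum_iff part_def)

lemma part_insert:
  assumes j: "j \<in> J"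
  shows "part (insert j K) = part K <+>\<^bsub>M\<^esub> part {j}"
proof
  have sub: "part K \<subseteq> part (insert j K)" "part {j} \<subseteq> part (insert j K)"
    by (auto simp: part_def)
  then show "part K <+>\<^bsub>M\<^esub> part {j} \<subseteq> part (insert j K)"
    using submoduleD(3)[OF part_submodule[of "insert j K"]] unfolding set_add_def' by blast
  show "part (insert j K) \<subseteq> part K <+>\<^bsub>M\<^esub> part {j}"
  proof
    fix x assume x: "x \<in> part (insert j K)"
    then have xU: "x \<in> U"
      by (simp add: part_def)
    have xj: "\<phi> x j \<in> carrier (B j)"
      using lmod_hom_closed[OF phi_component[OF j]] xU by simp
    obtain v where v: "v \<in> part {j}" "\<phi> v j = \<phi> x j"
      by (rule phi_single[OF j xj])
    have vU: "v \<in> U"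
      using v(1) by (simp add: part_def)
    interpret U: left_module R "M\<lparr>carrier := U\<rparr>"
      by (rule left_module_submodule[OF U])
    have M: "x \<in> carrier M" "v \<in> carrier M"
      using xU vU submoduleD(1)[OF U] by auto
    let ?u = "x \<oplus>\<^bsub>M\<^esub> (\<ominus>\<^bsub>M\<^esub> v)"
    have uU: "?u \<in> U"
      using xU vU submoduleD(3,4)[OF U] by simp
    have x_eq: "x = ?u \<oplus>\<^bsub>M\<^esub> v"
      using M by (simp add: M.a_assoc M.l_neg)
    have "\<phi> ?u i = \<zero>\<^bsub>B i\<^esub>" if i: "i \<in> J - K" for i
    proof -
      interpret Bi: left_module R "B i"
        using B i by simp
      have c: "\<phi> ?u i \<in> carrier (B i)" "\<phi> v i \<in> carrier (B i)"
        using lmod_hom_closed[OF phi_component] i uU vU by auto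
      have "\<phi> x i = \<phi> ?u i \<oplus>\<^bsub>B i\<^esub> \<phi> v i"
        using lmod_hom_add[OF phi_component, of i ?u v] i uU vU x_eq by simp
      moreover have "\<phi> x i = \<phi> v i"
        using v x i by (cases "i = j") (auto simp: part_def)
      ultimately show ?thesis
        using c Bi.M.add.r_cancel_one'[of "\<phi> v i" "\<phi> ?u i"] by simp
    qed
    then have "?u \<in> part K"
      using uU by (simp add: part_def)
    then show "x \<in> part K <+>\<^bsub>M\<^esub> part {j}"
      using v(1) x_eq by (auto simp: set_add_def')
  qed
qed

lemma part_disjoint:
  assumes "x \<in> part K" "x \<in> part {j}" "j \<notin> K"
  shows "x = \<zero>\<^bsub>M\<^esub>"
proof (rule phi_eqI)
  fix i assume "i \<in> J"
  then show "\<phi> x i = \<phi> \<zero>\<^bsub>M\<^esub> i"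
    using assms phi_zero[of i] by (cases "i = j") (auto simp: part_def)
qed (use assms submoduleD(2)[OF U] in \<open>auto simp: part_def\<close>)

lemma part_single_bij:
  assumes j: "j \<in> J"
  shows "bij_betw (\<lambda>x. \<phi> x j) (part {j}) (carrier (B j))"
  unfolding bij_betw_def
proof (intro conjI subset_antisym subsetI)
  show "inj_on (\<lambda>x. \<phi> x j) (part {j})"
  proof (rule inj_onI)
    fix x y assume xy: "x \<in> part {j}" "y \<in> part {j}" "\<phi> x j = \<phi> y j"
    then have "\<phi> x i = \<phi> y i" if "i \<in> J" for i
      using that by (cases "i = j") (auto simp: part_def)
    with xy show "x = y"
      by (intro phi_eqI) (auto simp: part_def)
  qed
  show "b \<in> carrier (B j)" if "b \<in> (\<lambda>x. \<phi> x j) ` part {j}" for b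
    using that lmod_hom_closed[OF phi_component[OF j]] by (auto simp: part_def)
  show "b \<in> (\<lambda>x. \<phi> x j) ` part {j}" if b: "b \<in> carrier (B j)" for b
    by (rule phi_single[OF j b]) (auto intro!: image_eqI)
qed

lemma part_single_hom:
  assumes j: "j \<in> J"
  shows "(\<lambda>x. \<phi> x j) \<in> lmod_hom R (M\<lparr>carrier := part {j}\<rparr>) (B j)"
  using lmod_hom_restrict_dom[OF phi_component[OF j], of "part {j}"] by (simp add: part_def)

text \<open>Only the finitely many coordinates occurring in the images of the generators can be nonzero.\<close>

lemma finitely_presented_finite_index:
  assumes fp: "finitely_presented R (M\<lparr>carrier := U\<rparr>)"
    and nz: "\<And>j. j \<in> J \<Longrightarrow> \<exists>x\<in>carrier (B j). x \<noteq> \<zero>\<^bsub>B j\<^esub>"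
  shows "finite J"
proof (rule ccontr)
  assume inf: "infinite J"
  obtain n g where g: "g \<in> lmod_hom R (free_module R n) (M\<lparr>carrier := U\<rparr>)"
    "g ` carrier (free_module R n) = U"
    using fp by (auto simp: finitely_presented_def)
  let ?e = "\<lambda>k. \<lambda>i\<in>{..<n}. if i = k then \<one>\<^bsub>R\<^esub> else \<zero>\<^bsub>R\<^esub>"
  let ?S = "\<Union>k<n. {j\<in>J. \<phi> (g (?e k)) j \<noteq> \<zero>\<^bsub>B j\<^esub>}"
  have e: "?e k \<in> carrier (free_module R n)" for k
    by (auto simp: carrier_free_module)
  have "finite {j\<in>J. \<phi> (g (?e k)) j \<noteq> \<zero>\<^bsub>B j\<^esub>}" for k
    using lmod_hom_closed[OF phi lmod_hom_closed[OF g(1) e]] by (simp add: carrier_direct_sum_iff)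
  then have "finite ?S"
    by simp
  then obtain j where j: "j \<in> J" "j \<notin> ?S"
    using inf finite_subset[of J ?S] by blast
  obtain b where b: "b \<in> carrier (B j)" "b \<noteq> \<zero>\<^bsub>B j\<^esub>"
    using nz[OF j(1)] by blast
  obtain v where v: "v \<in> part {j}" "\<phi> v j = b"
    by (rule phi_single[OF j(1) b(1)])
  then obtain x where x: "x \<in> carrier (free_module R n)" "g x = v"
    using g(2) by (auto simp: part_def)
  have "((\<lambda>x. \<phi> x j) \<circ> g) x = \<zero>\<^bsub>B j\<^esub>"
  proof (rule free_module_hom_zero[OF R.ring_axioms B[OF j(1)] _ _ x(1)])
    show "(\<lambda>x. \<phi> x j) \<circ> g \<in> lmod_hom R (free_module R n) (B j)"
      by (rule lmod_hom_comp[OF g(1) phi_component[OF j(1)]])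
    show "((\<lambda>x. \<phi> x j) \<circ> g) (?e k) = \<zero>\<^bsub>B j\<^esub>" if "k < n" for k
      using j that by auto
  qed
  then show False
    using x v b by simp
qed

lemma part_complement:
  assumes sb: "semibrick R \<B>" and BB: "\<And>j. j \<in> J \<Longrightarrow> B j \<in> \<B>"
    and ids: "internal_direct_sum R M I N"
    and N: "\<forall>i \<in> I. \<exists>C \<in> \<B>. lmod_isomorphic R (M\<lparr>carrier := N i\<rparr>) C"
    and K: "finite K" "K \<subseteq> J"
  shows "\<exists>I'\<subseteq>I. internal_direct_sum R M (insert None (Some ` I')) (case_option (part K) N)"
  using K
proof (induction K)
  case empty
  then show ?case
    using internal_direct_sum_insert_None[OF ids] by (auto simp: part_empty)
next
  case (insert j K)
  then obtain I' where I': "I' \<subseteq> I"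
    "internal_direct_sum R M (insert None (Some ` I')) (case_option (part K) N)"
    by auto
  let ?I = "insert None (Some ` I')" and ?N = "case_option (part K) N"
  let ?V = "part {j}"
  obtain p where p: "projections R M ?I ?N p"
    using I'(2) internal_direct_sum_iff_projections by blast
  have j: "j \<in> J"
    using insert by simp
  interpret Bj: left_module R "B j"
    by (rule B[OF j])
  have VM: "?V \<subseteq> carrier M"
    by (rule submoduleD(1)[OF part_submodule])
  obtain b where b: "b \<in> carrier (B j)" "b \<noteq> \<zero>\<^bsub>B j\<^esub>"
    using brick_nonzero[of R "B j"] sb BB[OF j] by (auto simp: semibrick_def)
  obtain v where v: "v \<in> ?V" "\<phi> v j = b"
    by (rule phi_single[OF j b(1)])
  have "v \<noteq> \<zero>\<^bsub>M\<^esub>"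
    using v b phi_zero[OF j] by auto
  then have "v \<notin> part K"
    using part_disjoint[OF _ v(1)] insert by blast
  have "\<exists>i\<in>I'. p (Some i) v \<noteq> \<zero>\<^bsub>M\<^esub>"
  proof (rule ccontr)
    assume "\<not> ?thesis"
    then have "p i v = \<zero>\<^bsub>M\<^esub>" if "i \<in> Some ` I'" for i
      using that by auto
    then have "v \<in> ?N None"
      using v VM by (intro projections_mem[OF p]) auto
    with \<open>v \<notin> part K\<close> show False
      by simp
  qed
  then obtain i where i: "i \<in> I'" "p (Some i) v \<noteq> \<zero>\<^bsub>M\<^esub>"
    by blast
  have iI: "Some i \<in> ?I"
    using i by simp
  obtain C f where C: "C \<in> \<B>" "f \<in> lmod_hom R (M\<lparr>carrier := N i\<rparr>) C"
    "bij_betw f (N i) (carrier C)"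
    using N I'(1) i(1) by (fastforce simp: lmod_isomorphic_def)
  have h: "p (Some i) \<in> lmod_hom R (M\<lparr>carrier := ?V\<rparr>) (M\<lparr>carrier := N i\<rparr>)"
    using lmod_hom_restrict_dom[OF projectionsD(2)[OF p iI] VM] by simp
  have "bij_betw (p (Some i)) (carrier (M\<lparr>carrier := ?V\<rparr>)) (carrier (M\<lparr>carrier := N i\<rparr>))"
  proof (rule semibrick_hom_bij[OF sb BB[OF j] C(1) _ _ part_single_hom[OF j] _ C(2) _ h])
    show "left_module R (M\<lparr>carrier := N i\<rparr>)"
      using left_module_submodule[OF projectionsD(1)[OF p iI]] by simp
  qed (use C part_single_bij[OF j] left_module_submodule[OF part_submodule] v i in simp_all)
  then have bij: "bij_betw (p (Some i)) ?V (?N (Some i))"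
    by simp
  have "internal_direct_sum R M (?I - {Some i}) (?N(None := ?N None <+>\<^bsub>M\<^esub> ?V))"
    by (rule internal_direct_sum_exchange[OF p iI _ _ part_submodule bij]) auto
  moreover have "?I - {Some i} = insert None (Some ` (I' - {i}))"
    by auto
  moreover have "?N(None := ?N None <+>\<^bsub>M\<^esub> ?V) = case_option (part (insert j K)) N"
    using part_insert[OF j, of K] by (simp add: fun_eq_iff split: option.split)
  ultimately have "internal_direct_sum R M (insert None (Some ` (I' - {i})))
      (case_option (part (insert j K)) N)"
    by simp
  then show ?case
    using I'(1) by (intro exI[of _ "I' - {i}"]) auto
qed

lemma brick_subset_part:
  assumes sb: "semibrick R \<B>" and BB: "\<And>j. j \<in> J \<Longrightarrow> B j \<in> \<B>"
    and ids: "internal_direct_sum R M I N"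
    and N: "\<forall>i \<in> I. \<exists>C \<in> \<B>. lmod_isomorphic R (M\<lparr>carrier := N i\<rparr>) C"
    and V: "submodule V R M" "C \<in> \<B>" "lmod_isomorphic R (M\<lparr>carrier := V\<rparr>) C"
    and x: "x \<in> V" "x \<in> U" "x \<noteq> \<zero>\<^bsub>M\<^esub>"
  shows "V \<subseteq> U"
proof -
  obtain K where K: "finite K" "K \<subseteq> J" "x \<in> part K"
    by (rule part_support[OF x(2)])
  obtain I' where I': "I' \<subseteq> I"
    "internal_direct_sum R M (insert None (Some ` I')) (case_option (part K) N)"
    using part_complement[OF sb BB ids N K(1,2)] by blast
  let ?I = "insert None (Some ` I')" and ?N = "case_option (part K) N"
  obtain p where p: "projections R M ?I ?N p"
    using I'(2) internal_direct_sum_iff_projections by blast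
  obtain f where f: "f \<in> lmod_hom R (M\<lparr>carrier := V\<rparr>) C" "bij_betw f V (carrier C)"
    using V(3) by (auto simp: lmod_isomorphic_def)
  have VM: "V \<subseteq> carrier M"
    by (rule submoduleD(1)[OF V(1)])
  have "p (Some i) v = \<zero>\<^bsub>M\<^esub>" if i: "i \<in> I'" and v: "v \<in> V" for i v
  proof (rule ccontr)
    assume nz: "p (Some i) v \<noteq> \<zero>\<^bsub>M\<^esub>"
    have iI: "Some i \<in> ?I"
      using i by simp
    obtain C' f' where C': "C' \<in> \<B>" "f' \<in> lmod_hom R (M\<lparr>carrier := N i\<rparr>) C'"
      "bij_betw f' (N i) (carrier C')"
      using N I'(1) i(1) by (fastforce simp: lmod_isomorphic_def)
    have h: "p (Some i) \<in> lmod_hom R (M\<lparr>carrier := V\<rparr>) (M\<lparr>carrier := N i\<rparr>)"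
      using lmod_hom_restrict_dom[OF projectionsD(2)[OF p iI] VM] by simp
    have "bij_betw (p (Some i)) (carrier (M\<lparr>carrier := V\<rparr>)) (carrier (M\<lparr>carrier := N i\<rparr>))"
    proof (rule semibrick_hom_bij[OF sb V(2) C'(1) left_module_submodule[OF V(1)] _ f(1) _ C'(2) _ h])
      show "left_module R (M\<lparr>carrier := N i\<rparr>)"
        using left_module_submodule[OF projectionsD(1)[OF p iI]] by simp
    qed (use C' f v nz in simp_all)
    then have inj: "inj_on (p (Some i)) V"
      by (simp add: bij_betw_def)
    have "p (Some i) z = \<zero>\<^bsub>M\<^esub>" if "z \<in> part K" for z
      using projectionsD(3)[OF p iI, of None z] that by simp
    then have "p (Some i) x = p (Some i) \<zero>\<^bsub>M\<^esub>"
      using K(3) submoduleD(2)[OF part_submodule] by simp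
    then show False
      using inj x submoduleD(2)[OF V(1)] by (auto dest: inj_onD)
  qed
  then have "v \<in> ?N None" if "v \<in> V" for v
    using that VM by (intro projections_mem[OF p]) auto
  then show ?thesis
    by (auto simp: part_def)
qed

end

end

theorem lemma3p4:
  fixes R :: "('r, 'e) ring_scheme"
    and \<B> :: "('r, 'b) module set"
    and M :: "('r, 'm) module"
    and I :: "'i set"
    and N :: "'i \<Rightarrow> 'm set"
  assumes "ring R"
    and "semibrick R \<B>"
    and "left_module R M"
    and "semisimple_over R \<B> M"
    and "internal_direct_sum R M I N"
    and "\<forall>i \<in> I. \<exists>B \<in> \<B>. lmod_isomorphic R (M\<lparr>carrier := N i\<rparr>) B"
  shows "(\<forall>U. submodule U R M \<and> finitely_presented R (M\<lparr>carrier := U\<rparr>)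
            \<and> semisimple_over R \<B> (M\<lparr>carrier := U\<rparr>) \<longrightarrow>
          (\<exists>I' \<subseteq> I. internal_direct_sum R M (insert None (Some ` I'))
            (\<lambda>j. case j of None \<Rightarrow> U | Some i \<Rightarrow> N i)))
       \<and> (\<forall>V U. submodule V R M \<and> (\<exists>B \<in> \<B>. lmod_isomorphic R (M\<lparr>carrier := V\<rparr>) B)
            \<and> submodule U R M \<and> semisimple_over R \<B> (M\<lparr>carrier := U\<rparr>)
            \<and> V \<inter> U \<noteq> {\<zero>\<^bsub>M\<^esub>} \<longrightarrow> V \<subseteq> U)"
proof (intro conjI allI impI; elim conjE)
  interpret left_module R M by fact
  have decomp: thesis
    if ss: "semisimple_over R \<B> (M\<lparr>carrier := U\<rparr>)"
      and elim: "\<And>J B \<phi>. (\<And>j. j \<in> J \<Longrightarrow> B j \<in> \<B>) \<Longrightarrow> (\<And>j. j \<in> J \<Longrightarrow> left_module R (B j)) \<Longrightarrow>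
        \<phi> \<in> lmod_hom R (M\<lparr>carrier := U\<rparr>) (direct_sum (J :: 'm set) B) \<Longrightarrow>
        bij_betw \<phi> U (carrier (direct_sum J B)) \<Longrightarrow> thesis" for U thesis
  proof -
    obtain J :: "'m set" and B where JB: "\<forall>j\<in>J. B j \<in> \<B>"
      "lmod_isomorphic R (M\<lparr>carrier := U\<rparr>) (direct_sum J B)"
      using ss by (auto simp: semisimple_over_def)
    then obtain \<phi> where "\<phi> \<in> lmod_hom R (M\<lparr>carrier := U\<rparr>) (direct_sum J B)"
      "bij_betw \<phi> U (carrier (direct_sum J B))"
      by (auto simp: lmod_isomorphic_def)
    moreover have "left_module R (B j)" if "j \<in> J" for j
      using assms(2) JB that by (auto simp: semibrick_def brick_def)
    ultimately show thesis
      using JB(1) by (intro elim) auto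
  qed
  {
    fix U assume U: "submodule U R M" "finitely_presented R (M\<lparr>carrier := U\<rparr>)"
      "semisimple_over R \<B> (M\<lparr>carrier := U\<rparr>)"
    show "\<exists>I' \<subseteq> I. internal_direct_sum R M (insert None (Some ` I'))
            (\<lambda>j. case j of None \<Rightarrow> U | Some i \<Rightarrow> N i)"
    proof (rule decomp[OF U(3)])
      fix J :: "'m set" and B \<phi>
      assume B: "\<And>j. j \<in> J \<Longrightarrow> B j \<in> \<B>" and *: "\<And>j. j \<in> J \<Longrightarrow> left_module R (B j)"
        "\<phi> \<in> lmod_hom R (M\<lparr>carrier := U\<rparr>) (direct_sum J B)" "bij_betw \<phi> U (carrier (direct_sum J B))"
      have "finite J"
        by (rule finitely_presented_finite_index[OF U(1) * U(2)])
          (use assms(2) B in \<open>auto simp: semibrick_def intro!: brick_nonzero\<close>)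
      from part_complement[OF U(1) * assms(2) B assms(5,6) this subset_refl]
      show ?thesis
        by simp
    qed
  next
    fix V U assume V: "submodule V R M" "\<exists>B\<in>\<B>. lmod_isomorphic R (M\<lparr>carrier := V\<rparr>) B"
      and U: "submodule U R M" "semisimple_over R \<B> (M\<lparr>carrier := U\<rparr>)"
      and VU: "V \<inter> U \<noteq> {\<zero>\<^bsub>M\<^esub>}"
    obtain x where x: "x \<in> V" "x \<in> U" "x \<noteq> \<zero>\<^bsub>M\<^esub>"
      using VU submoduleD(2)[OF V(1)] submoduleD(2)[OF U(1)] by blast
    obtain C where C: "C \<in> \<B>" "lmod_isomorphic R (M\<lparr>carrier := V\<rparr>) C"
      using V(2) by blast
    show "V \<subseteq> U"
    proof (rule decomp[OF U(2)])
      fix J :: "'m set" and B \<phi>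
      assume B: "\<And>j. j \<in> J \<Longrightarrow> B j \<in> \<B>" and *: "\<And>j. j \<in> J \<Longrightarrow> left_module R (B j)"
        "\<phi> \<in> lmod_hom R (M\<lparr>carrier := U\<rparr>) (direct_sum J B)" "bij_betw \<phi> U (carrier (direct_sum J B))"
      show ?thesis
        by (rule brick_subset_part[OF U(1) * assms(2) B assms(5,6) V(1) C x])
    qed
  }
qed

end
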